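(* For any integer $k>0$, $\lim_{n\to\infty}P_{n,k}=1$.
   Context: Hat guessing game with parameters $1\le k\le n$: there are $n$ players $p_1,\dots,p_n$. Hat colors $h=(h_1,\dots,h_n)$ are chosen uniformly at random from $\{0,1\}^n$. Player $p_i$ sees $h_{-i}=(h_1,\dots,h_{i-1},h_{i+1},\dots,h_n)\in\{0,1\}^{n-1}$, i.e. all hats but his own. A strategy is a collection of functions $\mathcal{S}=(s_1,\dots,s_n)$ with $s_i:\{0,1\}^{n-1}\to\{0,1,\bot\}$; player $p_i$ answers $s_i(h_{-i})$, where $\bot$ means "pass" (neither correct nor wrong). A non-pass answer is a correct guess if it equals $h_i$ and a wrong guess otherwise. The players win on $h$ if at least $k$ players guess correctly and no player guesses wrong. $P_{n,k}$ denotes the maximum over all strategies of the probability of winning. *)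

theory Defs
  imports "HOL-Probability.Probability"
begin

text \<open>
  Hat colours are booleans, players are the indices \<open>i < n\<close>, and a hat assignment is a
  list of length \<open>n\<close>. An answer is a \<^typ>\<open>bool option\<close>, where \<^const>\<open>None\<close> means pass.
\<close>

definition hats :: "nat \<Rightarrow> bool list set" where
  "hats n = {h. length h = n}"

definition others :: "nat \<Rightarrow> bool list \<Rightarrow> bool list" where
  "others i h = take i h @ drop (Suc i) h"

type_synonym strategy = "nat \<Rightarrow> bool list \<Rightarrow> bool option"

definition strategies :: "nat \<Rightarrow> strategy set" where
  "strategies n = {..<n} \<rightarrow>\<^sub>E (hats (n - 1) \<rightarrow>\<^sub>E UNIV)"

definition guesses_correctly :: "strategy \<Rightarrow> bool list \<Rightarrow> nat \<Rightarrow> bool" where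
  "guesses_correctly s h i \<longleftrightarrow> s i (others i h) = Some (h ! i)"

definition guesses_wrong :: "strategy \<Rightarrow> bool list \<Rightarrow> nat \<Rightarrow> bool" where
  "guesses_wrong s h i \<longleftrightarrow> (\<exists>c. s i (others i h) = Some c \<and> c \<noteq> h ! i)"

definition players_win :: "nat \<Rightarrow> nat \<Rightarrow> strategy \<Rightarrow> bool list \<Rightarrow> bool" where
  "players_win n k s h \<longleftrightarrow>
     k \<le> card {i. i < n \<and> guesses_correctly s h i} \<and> (\<forall>i<n. \<not> guesses_wrong s h i)"

definition win_prob :: "nat \<Rightarrow> nat \<Rightarrow> strategy \<Rightarrow> real" where
  "win_prob n k s = measure_pmf.prob (pmf_of_set (hats n)) {h. players_win n k s h}"

text \<open>
  This is also defined, with value \<open>0\<close>, when \<open>k > n\<close>.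
\<close>
definition max_win_prob :: "nat \<Rightarrow> nat \<Rightarrow> real" where
  "max_win_prob n k = Max (win_prob n k ` strategies n)"

lemma finite_hats: "finite (hats n)"
  using finite_lists_length_eq[of "UNIV :: bool set" n] by (simp add: hats_def)

lemma hats_nonempty: "hats n \<noteq> {}"
proof -
  have "replicate n False \<in> hats n" by (simp add: hats_def)
  then show ?thesis by blast
qed

lemma others_in_hats: "h \<in> hats n \<Longrightarrow> i < n \<Longrightarrow> others i h \<in> hats (n - 1)"
  by (auto simp: hats_def others_def)

lemma finite_strategies: "finite (strategies n)"
  by (auto simp: strategies_def intro!: finite_PiE finite_hats)

lemma strategies_nonempty: "strategies n \<noteq> {}"
  by (simp add: strategies_def PiE_eq_empty_iff)

lemma max_win_prob_ge: "s \<in> strategies n \<Longrightarrow> win_prob n k s \<le> max_win_prob n k"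
  unfolding max_win_prob_def by (intro Max_ge finite_imageI finite_strategies imageI)

lemma max_win_prob_attained: "\<exists>s\<in>strategies n. max_win_prob n k = win_prob n k s"
proof -
  have "max_win_prob n k \<in> win_prob n k ` strategies n"
    unfolding max_win_prob_def
    by (intro Max_in finite_imageI finite_strategies) (simp add: strategies_nonempty)
  then show ?thesis by blast
qed

lemma max_win_prob_eq_0:
  assumes "n < k"
  shows "max_win_prob n k = 0"
proof -
  have "\<not> players_win n k s h" for s h
  proof -
    have "card {i. i < n \<and> guesses_correctly s h i} \<le> card {..<n}"
      by (intro card_mono) auto
    then show ?thesis using assms by (simp add: players_win_def)
  qed
  then have "win_prob n k s = 0" for s by (simp add: win_prob_def)
  then show ?thesis using max_win_prob_attained[of n k] by auto
qed

end

theory Submission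
  imports Defs
begin

unbundle bit_operations_syntax

text \<open>
  View assignments as vertices of the hypercube. What player \<open>i\<close> sees is an edge of
  direction \<open>i\<close>, and a guess picks one of its two endpoints. Fix a set \<open>L\<close> of assignments on
  which the players accept to lose, and let each player who sees that exactly one endpoint of his
  edge lies in \<open>L\<close> bet on the other one. Outside \<open>L\<close> nobody is then wrong, and the number of
  correct guesses is the number of neighbours in \<open>L\<close>. So the players win outside \<open>L\<close> as soon
  as every vertex outside \<open>L\<close> has at least \<open>k\<close> neighbours in \<open>L\<close>
  (\<open>max_win_prob_ge_of_dominating\<close>), and it remains to find such sets of density
  tending to \<open>0\<close>.

  A union of \<open>k\<close> cosets of a Hamming code does this. Label coordinate \<open>i\<close> by \<open>i\<close> modulo
  \<open>2 ^ m\<close>, and let the syndrome of \<open>h\<close> be the bitwise exclusive or of the labels of the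
  coordinates that are \<open>True\<close>. Flipping coordinate \<open>i\<close> adds its label to the syndrome; hence,
  when \<open>n \<ge> 2 ^ m\<close>, one flip leads from any vertex to any prescribed syndrome below \<open>2 ^ m\<close>.
  Let \<open>L\<close> consist of the assignments with syndrome below \<open>k\<close>. A vertex outside \<open>L\<close> has a
  neighbour of each syndrome \<open>t < k\<close>, which makes \<open>k\<close> neighbours in \<open>L\<close>
  (\<open>card_syndrome_less_neighbours\<close>). All \<open>2 ^ m\<close> syndromes are equally frequent, so \<open>L\<close> has
  density at most \<open>k / 2 ^ m\<close> (\<open>card_syndrome_less\<close>).
\<close>

section \<open>Strategies from dominating sets\<close>

abbreviation flip :: "nat \<Rightarrow> bool list \<Rightarrow> bool list" where
  "flip i h \<equiv> h[i := \<not> h ! i]"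

definition insert_at :: "nat \<Rightarrow> bool \<Rightarrow> bool list \<Rightarrow> bool list" where
  "insert_at i c v = take i v @ c # drop i v"

lemma insert_at_others:
  assumes "i < length h"
  shows "insert_at i c (others i h) = h[i := c]"
  using assms by (simp add: insert_at_def others_def upd_conv_take_nth_drop)

lemma card_hats: "card (hats n) = 2 ^ n"
  using card_lists_length_eq[of "UNIV :: bool set" n] by (simp add: hats_def)

lemma length_hats: "h \<in> hats n \<Longrightarrow> length h = n"
  by (simp add: hats_def)

lemma flip_in_hats: "h \<in> hats n \<Longrightarrow> flip i h \<in> hats n"
  by (simp add: hats_def)

definition avoiding_strategy :: "nat \<Rightarrow> bool list set \<Rightarrow> strategy" where
  "avoiding_strategy n L = (\<lambda>i\<in>{..<n}. \<lambda>v\<in>hats (n - 1).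
     if (insert_at i False v \<in> L) = (insert_at i True v \<in> L) then None
     else Some (insert_at i False v \<in> L))"

lemma avoiding_strategy_in_strategies: "avoiding_strategy n L \<in> strategies n"
  by (auto simp: avoiding_strategy_def strategies_def)

lemma avoiding_strategy_outside:
  assumes "h \<in> hats n" "h \<notin> L" "i < n"
  shows "avoiding_strategy n L i (others i h) = (if flip i h \<in> L then Some (h ! i) else None)"
proof -
  have i: "i < length h"
    using assms by (simp add: hats_def)
  have "h[i := h ! i] = h"
    by simp
  then show ?thesis
    using assms others_in_hats[OF assms(1,3)]
    by (cases "h ! i") (simp_all add: avoiding_strategy_def insert_at_others[OF i])
qed

lemma players_win_avoiding_strategy:
  assumes "h \<in> hats n" "h \<notin> L" "k \<le> card {i. i < n \<and> flip i h \<in> L}"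
  shows "players_win n k (avoiding_strategy n L) h"
proof -
  have "{i. i < n \<and> guesses_correctly (avoiding_strategy n L) h i} = {i. i < n \<and> flip i h \<in> L}"
    using avoiding_strategy_outside[OF assms(1,2)]
    by (auto simp: guesses_correctly_def split: if_splits)
  then show ?thesis
    using assms(3) avoiding_strategy_outside[OF assms(1,2)]
    by (auto simp: players_win_def guesses_wrong_def split: if_splits)
qed

lemma win_prob_le_1: "win_prob n k s \<le> 1"
  by (simp add: win_prob_def)

lemma max_win_prob_le_1: "max_win_prob n k \<le> 1"
  using max_win_prob_attained[of n k] win_prob_le_1 by auto

lemma max_win_prob_ge_of_dominating:
  assumes "L \<subseteq> hats n"
    and dom: "\<And>h. h \<in> hats n - L \<Longrightarrow> k \<le> card {i. i < n \<and> flip i h \<in> L}"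
  shows "1 - card L / 2 ^ n \<le> max_win_prob n k"
proof -
  let ?s = "avoiding_strategy n L"
  have fin: "finite L"
    using assms(1) finite_hats finite_subset by blast
  have "card L \<le> (2::nat) ^ n"
    using card_mono[OF finite_hats assms(1)] by (simp add: card_hats)
  then have "1 - card L / 2 ^ n = real (card (hats n - L)) / 2 ^ n"
    by (simp add: card_Diff_subset[OF fin assms(1)] card_hats diff_divide_distrib)
  also have "\<dots> \<le> real (card (hats n \<inter> {h. players_win n k ?s h})) / 2 ^ n"
    using players_win_avoiding_strategy dom
    by (intro divide_right_mono of_nat_mono card_mono) (auto simp: finite_hats)
  also have "\<dots> = win_prob n k ?s"
    by (simp add: win_prob_def measure_pmf_of_set finite_hats hats_nonempty card_hats)
  also have "\<dots> \<le> max_win_prob n k"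
    by (intro max_win_prob_ge avoiding_strategy_in_strategies)
  finally show ?thesis .
qed

section \<open>Hamming syndromes\<close>

text \<open>
  The argument \<open>j\<close> is the index of the first entry of the list, so that
  the labels of the remaining entries survive the recursion.
\<close>
primrec syndrome_from :: "nat \<Rightarrow> nat \<Rightarrow> bool list \<Rightarrow> nat" where
  "syndrome_from m j [] = 0"
| "syndrome_from m j (b # h) = (if b then take_bit m j else 0) XOR syndrome_from m (Suc j) h"

abbreviation syndrome :: "nat \<Rightarrow> bool list \<Rightarrow> nat" where
  "syndrome m \<equiv> syndrome_from m 0"

lemma xor_less_power2:
  fixes a b :: nat
  assumes "a < 2 ^ m" "b < 2 ^ m"
  shows "a XOR b < 2 ^ m"
  using assms by (simp flip: take_bit_nat_eq_self_iff)

lemma xor_xor_cancel_left: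
  fixes a b :: nat
  shows "a XOR (a XOR b) = b"
  by (simp flip: xor.assoc)

lemma syndrome_from_less: "syndrome_from m j h < 2 ^ m"
  by (induction h arbitrary: j) (auto intro!: xor_less_power2)

lemma syndrome_from_flip:
  "i < length h \<Longrightarrow>
    syndrome_from m j (flip i h) = syndrome_from m j h XOR take_bit m (j + i)"
proof (induction h arbitrary: i j)
  case (Cons b h)
  show ?case
  proof (cases i)
    case 0
    then show ?thesis by (cases b) (simp_all add: xor.commute xor_xor_cancel_left)
  next
    case (Suc i')
    then show ?thesis using Cons.IH[of i' "Suc j"] Cons.prems by (simp add: ac_simps)
  qed
qed simp

text \<open>
  The label needed for moving from the syndrome of \<open>h\<close> to \<open>t\<close> is their exclusive or, and
  below \<open>2 ^ m\<close> a coordinate is its own label.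
\<close>
lemma syndrome_flip_xor:
  assumes "2 ^ m \<le> n" "h \<in> hats n" "t < 2 ^ m"
  shows "syndrome m h XOR t < n" and "syndrome m (flip (syndrome m h XOR t) h) = t"
proof -
  let ?i = "syndrome m h XOR t"
  have less: "?i < 2 ^ m"
    using assms(3) syndrome_from_less by (intro xor_less_power2)
  then show "?i < n"
    using assms(1) by simp
  then have "syndrome m (flip ?i h) = syndrome m h XOR take_bit m ?i"
    using assms(2) by (simp add: syndrome_from_flip length_hats)
  also have "\<dots> = t"
    unfolding take_bit_nat_eq_self[OF less] by (rule xor_xor_cancel_left)
  finally show "syndrome m (flip ?i h) = t" .
qed

lemma card_syndrome_less_neighbours:
  assumes "2 ^ m \<le> n" "h \<in> hats n" "k \<le> syndrome m h"
  shows "k \<le> card {i. i < n \<and> syndrome m (flip i h) < k}"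
proof -
  let ?i = "\<lambda>t. syndrome m h XOR t"
  have k: "k < 2 ^ m"
    using assms(3) syndrome_from_less le_less_trans by blast
  have "inj_on ?i {..<k}"
    by (rule inj_on_inverseI[where g = ?i]) (rule xor_xor_cancel_left)
  then have "k = card (?i ` {..<k})"
    by (simp add: card_image)
  also have "\<dots> \<le> card {i. i < n \<and> syndrome m (flip i h) < k}"
    using syndrome_flip_xor[OF assms(1,2)] k by (intro card_mono) auto
  finally show ?thesis .
qed

text \<open>
  Flipping the coordinate \<open>s XOR t\<close> is an involution that exchanges the assignments of
  syndrome \<open>s\<close> with those of syndrome \<open>t\<close>.
\<close>
lemma card_syndrome_fibre_le:
  assumes "2 ^ m \<le> n" "s < 2 ^ m" "t < 2 ^ m"
  shows "card {h \<in> hats n. syndrome m h = s} \<le> card {h \<in> hats n. syndrome m h = t}"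
proof (rule card_inj_on_le)
  let ?i = "s XOR t"
  have i: "?i < n"
    using assms xor_less_power2[of s m t] by simp
  have "flip ?i (flip ?i h) = h" if "h \<in> hats n" for h
    using that i by (simp add: length_hats)
  then show "inj_on (flip ?i) {h \<in> hats n. syndrome m h = s}"
    by (intro inj_on_inverseI[where g = "flip ?i"]) simp
  show "flip ?i ` {h \<in> hats n. syndrome m h = s} \<subseteq> {h \<in> hats n. syndrome m h = t}"
    using syndrome_flip_xor(2)[OF assms(1) _ assms(3)] by (auto simp: flip_in_hats)
qed (simp add: finite_hats)

lemma card_syndrome_fibre:
  assumes "2 ^ m \<le> n" "t < 2 ^ m"
  shows "2 ^ m * card {h \<in> hats n. syndrome m h = t} = 2 ^ n"
proof -
  have "2 ^ n = card (\<Union>s\<in>{..<2 ^ m}. {h \<in> hats n. syndrome m h = s})"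
    by (subst card_hats[symmetric], rule arg_cong[where f = card])
      (auto simp: syndrome_from_less)
  also have "\<dots> = (\<Sum>s<2 ^ m. card {h \<in> hats n. syndrome m h = s})"
    by (rule card_UN_disjoint) (auto simp: finite_hats)
  also have "\<dots> = (\<Sum>s<(2::nat) ^ m. card {h \<in> hats n. syndrome m h = t})"
    using assms by (intro sum.cong refl antisym card_syndrome_fibre_le) auto
  finally show ?thesis
    by simp
qed

lemma card_syndrome_less:
  assumes "2 ^ m \<le> n"
  shows "2 ^ m * card {h \<in> hats n. syndrome m h < k} \<le> k * 2 ^ n"
proof -
  let ?F = "\<lambda>t. {h \<in> hats n. syndrome m h = t}"
  have fibre: "2 ^ m * card (?F t) \<le> 2 ^ n" for t
  proof (cases "t < 2 ^ m")
    case True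
    then show ?thesis using card_syndrome_fibre[OF assms] by simp
  next
    case False
    then have "?F t = {}" using syndrome_from_less[of m 0] by auto
    then show ?thesis by (simp only: card.empty mult_0_right zero_le)
  qed
  have "{h \<in> hats n. syndrome m h < k} = (\<Union>t\<in>{..<k}. ?F t)"
    by auto
  then have "2 ^ m * card {h \<in> hats n. syndrome m h < k} \<le> 2 ^ m * (\<Sum>t<k. card (?F t))"
    by (simp add: card_UN_le)
  also have "\<dots> \<le> (\<Sum>t<k. 2 ^ n)"
    unfolding sum_distrib_left by (intro sum_mono fibre)
  finally show ?thesis
    by simp
qed

section \<open>The limit\<close>

lemma max_win_prob_ge_power2:
  assumes "2 ^ m \<le> n"
  shows "1 - k / 2 ^ m \<le> max_win_prob n k"
proof -
  let ?L = "{h \<in> hats n. syndrome m h < k}"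
  have "real (2 ^ m * card ?L) \<le> real (k * 2 ^ n)"
    using card_syndrome_less[OF assms] of_nat_le_iff by blast
  then have "card ?L / 2 ^ n \<le> k / 2 ^ m"
    by (simp add: field_simps)
  moreover have "1 - card ?L / 2 ^ n \<le> max_win_prob n k"
    using card_syndrome_less_neighbours[OF assms]
    by (intro max_win_prob_ge_of_dominating) (auto simp: flip_in_hats)
  ultimately show ?thesis
    by linarith
qed

theorem corollary16:
  fixes k :: nat
  assumes "k > 0"
  shows "(\<lambda>n. max_win_prob n k) \<longlonglongrightarrow> 1"
proof (rule LIMSEQ_I)
  fix \<epsilon> :: real
  assume "\<epsilon> > 0"
  obtain m where "k / \<epsilon> < 2 ^ m"
    using real_arch_pow[of 2 "k / \<epsilon>"] by auto
  then have m: "k / 2 ^ m < \<epsilon>"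
    using \<open>\<epsilon> > 0\<close> by (simp add: field_simps)
  have "norm (max_win_prob n k - 1) < \<epsilon>" if "2 ^ m \<le> n" for n
    using max_win_prob_ge_power2[OF that, of k] max_win_prob_le_1[of n k] m by simp
  then show "\<exists>N. \<forall>n\<ge>N. norm (max_win_prob n k - 1) < \<epsilon>"
    by blast
qed

end
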